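(* Let $G=(V,D)$ be an acyclic directed graph and let $A,B\subseteq V$ have the same cardinality $k$, with fixed linear orderings $a_1,\dots,a_k$ of $A$ and $b_1,\dots,b_k$ of $B$. If two trek systems $\mathbf{T}$ and $\mathbf{T}'$ from $A$ to $B$, both without sided intersection, satisfy $m_{\mathbf{T}}=m_{\mathbf{T}'}$, then $\mathrm{sign}(\mathbf{T})=\mathrm{sign}(\mathbf{T}')$.
   Context: $G=(V,D)$ is a finite directed graph without loops or multiple edges; each edge $i\to j$ carries an indeterminate $\lambda_{ij}$ and each vertex $i$ an indeterminate $\omega_{ii}$. A path is a sequence of directed edges where the head of each is the tail of the next (empty paths at a specified vertex allowed). A trek from $i$ to $j$ is a pair $T=(P_L,P_R)$ of directed paths starting at a common vertex $s$ (the top), with $P_L$ ending at $i$ (the initial vertex of the trek) and $P_R$ ending at $j$ (the final vertex). Its trek monomial is $m_T=\omega_{ss}\prod_{k\to l\in P_L}\lambda_{kl}\prod_{k\to l\in P_R}\lambda_{kl}$ (with multiplicities). A trek system from $A$ to $B$ is a set of $k$ treks whose initial vertices exhaust $A$ and whose final vertices exhaust $B$; it determines $\pi\in\mathfrak{S}_k$ by: the trek with initial vertex $a_i$ has final vertex $b_{\pi(i)}$, and $\mathrm{sign}(\mathbf{T}):=\mathrm{sign}(\pi)$. The trek system monomial $m_{\mathbf{T}}$ is the product of $m_T$ over $T\in\mathbf{T}$. A trek system has no sided intersection if the left paths $P_L$ of its treks are pairwise vertex-disjoint and the right paths $P_R$ are pairwise vertex-disjoint. *)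

theory Defs
  imports
    "Graph_Theory.Pair_Digraph"
    "HOL-Library.Poly_Mapping"
    "HOL-Combinatorics.Permutations"
begin

datatype 'v indet = Lambda 'v 'v | Omega 'v

text \<open>
  The polynomial ring over the reals in these indeterminates: a polynomial maps each exponent
  vector to its coefficient.
\<close>
type_synonym 'v trek_poly = "('v indet \<Rightarrow>\<^sub>0 nat) \<Rightarrow>\<^sub>0 real"

definition indet_poly :: "'v indet \<Rightarrow> 'v trek_poly" where
  "indet_poly x = Poly_Mapping.single (Poly_Mapping.single x 1) 1"

text \<open>
  The two paths of a trek are given by their arc lists. Since a path may be empty, their common
  starting vertex is recorded separately.
\<close>
record 'v trek =
  trek_top :: 'v
  trek_left :: "('v \<times> 'v) awalk"
  trek_right :: "('v \<times> 'v) awalk"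

definition left_verts :: "'v trek \<Rightarrow> 'v list" where
  "left_verts T = pawalk_verts (trek_top T) (trek_left T)"

definition right_verts :: "'v trek \<Rightarrow> 'v list" where
  "right_verts T = pawalk_verts (trek_top T) (trek_right T)"

definition trek_initial :: "'v trek \<Rightarrow> 'v" where
  "trek_initial T = last (left_verts T)"

definition trek_final :: "'v trek \<Rightarrow> 'v" where
  "trek_final T = last (right_verts T)"

definition is_trek :: "'v pair_pre_digraph \<Rightarrow> 'v trek \<Rightarrow> bool" where
  "is_trek G T \<longleftrightarrow>
     pre_digraph.awalk (with_proj G) (trek_top T) (trek_left T) (trek_initial T) \<and>
     pre_digraph.awalk (with_proj G) (trek_top T) (trek_right T) (trek_final T)"

definition path_monomial :: "('v \<times> 'v) awalk \<Rightarrow> 'v trek_poly" where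
  "path_monomial p = (\<Prod>(k, l)\<leftarrow>p. indet_poly (Lambda k l))"

definition trek_monomial :: "'v trek \<Rightarrow> 'v trek_poly" where
  "trek_monomial T =
     indet_poly (Omega (trek_top T)) * path_monomial (trek_left T) * path_monomial (trek_right T)"

definition is_trek_system ::
  "'v pair_pre_digraph \<Rightarrow> nat \<Rightarrow> 'v set \<Rightarrow> 'v set \<Rightarrow> 'v trek set \<Rightarrow> bool" where
  "is_trek_system G k A B TT \<longleftrightarrow>
     finite TT \<and> card TT = k \<and> (\<forall>T\<in>TT. is_trek G T) \<and>
     trek_initial ` TT = A \<and> trek_final ` TT = B"

definition system_monomial :: "'v trek set \<Rightarrow> 'v trek_poly" where
  "system_monomial TT = (\<Prod>T\<in>TT. trek_monomial T)"

definition no_sided_intersection :: "'v trek set \<Rightarrow> bool" where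
  "no_sided_intersection TT \<longleftrightarrow>
     pairwise (\<lambda>T T'. disjnt (set (left_verts T)) (set (left_verts T'))) TT \<and>
     pairwise (\<lambda>T T'. disjnt (set (right_verts T)) (set (right_verts T'))) TT"

definition is_system_perm ::
  "nat \<Rightarrow> (nat \<Rightarrow> 'v) \<Rightarrow> (nat \<Rightarrow> 'v) \<Rightarrow> 'v trek set \<Rightarrow> (nat \<Rightarrow> nat) \<Rightarrow> bool" where
  "is_system_perm k a b TT \<pi> \<longleftrightarrow>
     \<pi> permutes {1..k} \<and>
     (\<forall>T\<in>TT. \<forall>i\<in>{1..k}. trek_initial T = a i \<longrightarrow> trek_final T = b (\<pi> i))"

definition system_perm ::
  "nat \<Rightarrow> (nat \<Rightarrow> 'v) \<Rightarrow> (nat \<Rightarrow> 'v) \<Rightarrow> 'v trek set \<Rightarrow> nat \<Rightarrow> nat" where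
  "system_perm k a b TT = (THE \<pi>. is_system_perm k a b TT \<pi>)"

definition system_sign :: "nat \<Rightarrow> (nat \<Rightarrow> 'v) \<Rightarrow> (nat \<Rightarrow> 'v) \<Rightarrow> 'v trek set \<Rightarrow> int" where
  "system_sign k a b TT = sign (system_perm k a b TT)"

lemma ex1_system_perm:
  assumes a: "bij_betw a {1..k} A" and b: "bij_betw b {1..k} B"
    and TT: "is_trek_system G k A B TT"
  shows "\<exists>!\<pi>. is_system_perm k a b TT \<pi>"
proof -
  have cA: "card A = k" and cB: "card B = k"
    using bij_betw_same_card[OF a] bij_betw_same_card[OF b] by auto
  have fin: "finite TT" "card TT = k" "trek_initial ` TT = A" "trek_final ` TT = B"
    using TT by (auto simp: is_trek_system_def)
  have ini: "bij_betw trek_initial TT A"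
    using fin cA by (metis bij_betw_def eq_card_imp_inj_on)
  have fnl: "bij_betw trek_final TT B"
    using fin cB by (metis bij_betw_def eq_card_imp_inj_on)
  define \<tau> where "\<tau> i = inv_into TT trek_initial (a i)" for i
  have \<tau>: "bij_betw \<tau> {1..k} TT"
    using bij_betw_trans[OF a bij_betw_inv_into[OF ini]] by (simp add: \<tau>_def[abs_def] o_def)
  have \<tau>_eq: "\<tau> i = T" if "T \<in> TT" "trek_initial T = a i" for T i
    using ini that by (metis \<tau>_def bij_betw_inv_into_left)
  have \<tau>_ini: "trek_initial (\<tau> i) = a i" if "i \<in> {1..k}" for i
    using ini a that by (metis \<tau>_def bij_betw_inv_into_right bij_betw_apply)
  define p where "p i = inv_into {1..k} b (trek_final (\<tau> i))" for i
  have p: "bij_betw p {1..k} {1..k}"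
    using bij_betw_trans[OF bij_betw_trans[OF \<tau> fnl] bij_betw_inv_into[OF b]]
    by (simp add: p_def[abs_def] o_def)
  have bp: "b (p i) = trek_final (\<tau> i)" if "i \<in> {1..k}" for i
    using b fnl \<tau> that by (metis p_def bij_betw_inv_into_right bij_betw_apply)
  define \<pi> where "\<pi> i = (if i \<in> {1..k} then p i else i)" for i
  have "bij_betw \<pi> {1..k} {1..k}"
    using p by (rule bij_betw_cong[THEN iffD1, rotated]) (simp add: \<pi>_def)
  then have perm: "\<pi> permutes {1..k}"
    by (rule bij_imp_permutes) (auto simp: \<pi>_def)
  show ?thesis
  proof (rule ex1I[of _ \<pi>])
    show "is_system_perm k a b TT \<pi>"
      using perm \<tau>_eq bp unfolding is_system_perm_def by (metis \<pi>_def)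
  next
    fix \<sigma> assume \<sigma>: "is_system_perm k a b TT \<sigma>"
    show "\<sigma> = \<pi>"
    proof
      fix i
      show "\<sigma> i = \<pi> i"
      proof (cases "i \<in> {1..k}")
        case True
        have "\<tau> i \<in> TT" using \<tau> True by (metis bij_betw_apply)
        then have "trek_final (\<tau> i) = b (\<sigma> i)"
          using \<sigma> True \<tau>_ini unfolding is_system_perm_def by blast
        then have "b (\<sigma> i) = b (\<pi> i)" using bp True by (simp add: \<pi>_def)
        moreover have "\<sigma> i \<in> {1..k}" "\<pi> i \<in> {1..k}"
          using True \<sigma> perm permutes_in_image[of _ "{1..k}" i]
          unfolding is_system_perm_def by blast+
        ultimately show ?thesis using b by (metis bij_betw_def inj_onD)
      next
        case False
        then show ?thesis using \<sigma> perm unfolding is_system_perm_def permutes_def by metis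
      qed
    qed
  qed
qed

end

(* Fix an enumeration s of the set of tops, which is read off the monomial. The left paths, closed up
   by sending a_i to s_i and fixing every vertex off the paths, form a permutation f of the vertices;
   the right paths give g in the same way. Decomposing f into the disjoint cycles of the single
   paths followed by a permutation of the tops shows that sign f differs from the sign of the
   bijection between tops and initial vertices by (-1) to the number of arcs, so the sign of the
   system is sign f * sign g up to a factor determined by the degree of the monomial. The monomial
   also determines the pair {f x, g x} at every vertex x, hence two systems with the same monomial
   have permutations f, g and f', g' that only differ by exchanging f x and g x at some vertices.
   Then the inverse of f' composed with f is inverse to the inverse of g' composed with g, which
   gives sign f' * sign g' = sign f * sign g. *)

theory Submission
  imports Defs "HOL-Combinatorics.Cycles"
begin

section \<open>Cycles along directed walks\<close>

text \<open>The cycle is a product of one transposition for each pair of neighbours in the list, and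
  distinctness makes each of them odd. Truncated subtraction covers the empty list, whose cycle is
  \<open>id\<close>.\<close>

lemma sign_cycle_of_list:
  assumes "distinct xs"
  shows "sign (cycle_of_list xs) = (-1) ^ (length xs - 1)"
  using assms
proof (induction xs rule: cycle_of_list.induct)
  case (1 i j cs)
  then show ?case
    by (simp add: sign_compose permutation_swap_id permutation_of_cycle sign_swap_id
             del: o_apply)
qed simp_all

lemma pawalk_verts_pcas: "pcas u p v \<Longrightarrow> pawalk_verts u p = u # map snd p"
  by (induction u p v rule: pcas.induct) auto

lemma pcas_last_in: "pcas u p v \<Longrightarrow> v \<in> set (pawalk_verts u p)"
  by (induction u p v rule: pcas.induct) auto

lemma arc_in_pawalk_verts:
  assumes "pcas u p v" "(x, y) \<in> set p"
  shows "x \<in> set (pawalk_verts u p)"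
  using assms by (induction u p v rule: pcas.induct) auto

lemma pawalk_verts_arc:
  assumes "pcas u p v" "x \<in> set (pawalk_verts u p)" "x \<noteq> v"
  shows "\<exists>y. (x, y) \<in> set p"
  using assms by (induction u p v rule: pcas.induct) auto

lemma arc_start_not_last:
  assumes "pcas u p v" "distinct (pawalk_verts u p)" "(x, y) \<in> set p"
  shows "x \<noteq> v"
  using assms by (induction u p v rule: pcas.induct) (auto dest: pcas_last_in)

text \<open>Prepending an arc from \<open>u\<close> to \<open>w\<close> composes the cycle with
  \<open>transpose u w\<close>. This redirects the return of the last vertex from \<open>w\<close>
  to \<open>u\<close>, sends \<open>u\<close> to \<open>w\<close>, and leaves the other arcs alone,
  since their heads are neither \<open>u\<close> nor \<open>w\<close>.\<close>

lemma cycle_of_walk: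
  assumes "pcas u p v" "distinct (pawalk_verts u p)"
  shows "cycle_of_list (pawalk_verts u p) v = u"
    and "(x, y) \<in> set p \<Longrightarrow> cycle_of_list (pawalk_verts u p) x = y"
proof -
  have "cycle_of_list (pawalk_verts u p) v = u \<and>
    (\<forall>(x, y) \<in> set p. cycle_of_list (pawalk_verts u p) x = y)"
    using assms
  proof (induction u p v rule: pcas.induct)
    case (2 u e es v)
    let ?w = "snd e"
    let ?c = "cycle_of_list (pawalk_verts ?w es)"
    have cas: "pcas ?w es v" and e: "fst e = u" and dist: "distinct (pawalk_verts ?w es)"
      and u: "u \<notin> set (pawalk_verts ?w es)"
      using 2 by auto
    note verts = pawalk_verts_pcas[OF cas]
    have c: "cycle_of_list (pawalk_verts u (e # es)) = transpose u ?w \<circ> ?c"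
      by (simp add: verts e)
    have "?c u = u" using u by (rule id_outside_supp)
    moreover have "transpose u ?w y = y" if "(x, y) \<in> set es" for x y
      using that u dist by (intro transpose_apply_other) (auto simp: verts image_iff Bex_def)
    ultimately show ?case
      using "2.IH"[OF cas dist] e unfolding c by auto
  qed simp
  then show "cycle_of_list (pawalk_verts u p) v = u"
    and "(x, y) \<in> set p \<Longrightarrow> cycle_of_list (pawalk_verts u p) x = y"
    by auto
qed

lemma pawalk_verts_reachable:
  assumes "pcas u p v" "set p \<subseteq> E" "x \<in> set (pawalk_verts u p)"
  shows "(u, x) \<in> E\<^sup>*"
  using assms
  by (induction u p v rule: pcas.induct) (auto intro: converse_rtrancl_into_rtrancl)

text \<open>A repeated vertex would close a directed cycle. This is where acyclicity enters: it
  makes every walk of a trek a path, so that its vertex list defines a cycle.\<close>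

lemma acyclic_distinct_pawalk_verts:
  assumes "acyclic E" "pcas u p v" "set p \<subseteq> E"
  shows "distinct (pawalk_verts u p)"
  using assms(2,3)
proof (induction u p v rule: pcas.induct)
  case (2 u e es v)
  have "(u, snd e) \<in> E" using 2 by auto
  then have "u \<notin> set (pawalk_verts (snd e) es)"
    using pawalk_verts_reachable[of "snd e" es v E u] 2 assms(1)
    by (auto simp: acyclic_def dest: rtrancl_into_trancl2)
  with 2 show ?case by auto
qed simp

section \<open>Signs of products of permutations\<close>

text \<open>The witness is the product of the cycles. Disjoint supports ensure that on each
  \<open>P i\<close> only its own cycle acts, so the signs multiply and the values can be read off
  locally.\<close>

lemma disjoint_cycles:
  assumes "finite I"
    and "\<And>i. i \<in> I \<Longrightarrow> distinct (P i)"
    and "\<And>i j. i \<in> I \<Longrightarrow> j \<in> I \<Longrightarrow> i \<noteq> j \<Longrightarrow> set (P i) \<inter> set (P j) = {}"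
  shows "\<exists>c. c permutes (\<Union>i\<in>I. set (P i)) \<and> sign c = (-1) ^ (\<Sum>i\<in>I. length (P i) - 1) \<and>
    (\<forall>i\<in>I. \<forall>x\<in>set (P i). c x = cycle_of_list (P i) x)"
  using assms
proof (induction I rule: finite_induct)
  case empty
  then show ?case by (intro exI[of _ id]) (auto simp: permutes_id)
next
  case (insert j I)
  let ?U = "\<Union>i\<in>I. set (P i)"
  obtain c where c: "c permutes ?U" "sign c = (-1) ^ (\<Sum>i\<in>I. length (P i) - 1)"
    "\<forall>i\<in>I. \<forall>x\<in>set (P i). c x = cycle_of_list (P i) x"
    using insert.IH insert.prems by (metis insertCI)
  let ?d = "cycle_of_list (P j)"
  have d: "?d permutes set (P j)" by (rule cycle_permutes)
  have disj: "set (P j) \<inter> ?U = {}"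
    using insert.prems(2)[of j] insert.hyps by blast
  have perm: "permutation c" "permutation ?d"
    using permutes_imp_permutation[OF _ c(1)] insert.hyps by (auto intro: permutation_of_cycle)
  have "c \<circ> ?d permutes (\<Union>i\<in>insert j I. set (P i))"
    using permutes_subset[OF c(1)] permutes_subset[OF d] by (intro permutes_compose) auto
  moreover have "sign (c \<circ> ?d) = (-1) ^ (\<Sum>i\<in>insert j I. length (P i) - 1)"
    using perm insert.hyps insert.prems(1)[of j]
    by (simp add: sign_compose c(2) sign_cycle_of_list power_add mult.commute)
  moreover have "(c \<circ> ?d) x = cycle_of_list (P i) x"
    if "i \<in> insert j I" "x \<in> set (P i)" for i x
  proof (cases "i = j")
    case True
    then have "?d x \<in> set (P j)" using that d permutes_in_image by metis
    then have "?d x \<notin> ?U" using disj by blast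
    then show ?thesis using True permutes_not_in[OF c(1)] by simp
  next
    case False
    then have "x \<in> ?U" using that by auto
    then have "?d x = x" using disj permutes_not_in[OF d] by auto
    with False that c(3) show ?thesis by auto
  qed
  ultimately show ?case by blast
qed

text \<open>Exchanging values at some points may change the parity of \<open>f\<close> and of
  \<open>g\<close>, but it changes both or neither: the corrections \<open>t\<close> and
  \<open>t'\<close> are mutually inverse and hence of equal sign.\<close>

lemma sign_exchange:
  assumes perm: "permutation f" "permutation g" "permutation f'" "permutation g'"
    and ex: "\<And>x. f' x = f x \<and> g' x = g x \<or> f' x = g x \<and> g' x = f x"
  shows "sign f' * sign g' = sign f * sign g"
proof -
  \<comment> \<open>Points where the exchange makes no difference, that is \<open>f x = g x\<close>,
    are counted as unexchanged.\<close>
  define C where "C = {x. \<not> (f' x = f x \<and> g' x = g x)}"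
  have bij: "bij f" "bij g" "bij f'" "bij g'"
    using perm permutation_bijective by blast+
  have C: "f' x = g x" "g' x = f x" if "x \<in> C" for x
    using ex[of x] that by (auto simp: C_def)
  have nC: "f' x = f x" "g' x = g x" if "x \<notin> C" for x
    using that by (auto simp: C_def)
  define t where "t = inv f' \<circ> f"
  define t' where "t' = inv g' \<circ> g"
  have f't: "f' (t x) = f x" and g't': "g' (t' x) = g x" for x
    using bij by (simp_all add: t_def t'_def bij_is_surj surj_f_inv_f)
  have t_fix: "t x = x" and t'_fix: "t' x = x" if "x \<notin> C" for x
    using f't[of x] g't'[of x] nC[OF that] bij by (metis bij_def injD)+
  have "t (t' x) = x" for x
  proof (cases "x \<in> C")
    case True
    have "inj t'" using bij by (simp add: t'_def bij_is_inj inj_compose bij_imp_bij_inv)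
    \<comment> \<open>Outside \<open>C\<close> the point \<open>t' x\<close> would be fixed by
      \<open>t'\<close>, and injectivity would give \<open>t' x = x\<close>, which lies in
      \<open>C\<close>.\<close>
    then have "t' x \<in> C" using t'_fix True by (metis injD)
    then have "f' (t (t' x)) = g' (t' x)" by (simp add: f't C)
    also have "\<dots> = f' x" by (simp add: g't' C True)
    finally show ?thesis using bij by (simp add: bij_is_inj inj_eq)
  qed (simp add: t_fix t'_fix)
  then have "t \<circ> t' = id" by auto
  moreover have "sign (t \<circ> t') = sign f' * sign f * (sign g' * sign g)"
    using perm by (simp add: t_def t'_def sign_compose permutation_compose permutation_inverse
      sign_inverse del: o_apply)
  ultimately have "sign f' * sign f * (sign g' * sign g) = 1" by simp
  then show ?thesis by (auto simp: sign_def split: if_splits)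
qed

section \<open>Closing a family of disjoint paths to a permutation\<close>

lemma arc_ends_neq:
  assumes "pcas u p v" "distinct (pawalk_verts u p)" "(x, y) \<in> set p"
  shows "x \<noteq> y" "y \<noteq> u" "y \<in> set (pawalk_verts u p)"
proof -
  show "y \<noteq> u" "y \<in> set (pawalk_verts u p)"
    using assms by (force simp: pawalk_verts_pcas)+
  show "x \<noteq> y"
    using assms by (induction u p v rule: pcas.induct) (auto simp: pawalk_verts_pcas)
qed

lemma distinct_count_list: "distinct xs \<Longrightarrow> count_list xs x = of_bool (x \<in> set xs)"
  by (induction xs) auto

text \<open>The permutation \<open>f\<close> follows each arc forward, and at the end
  \<open>a i\<close> of a path it jumps to \<open>s i\<close> instead of to the start of the same
  path. A path with n arcs contributes a cycle of sign (-1)^n, and the change of return points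
  contributes \<open>sign \<alpha>\<close>. The arcs in use can be recovered from \<open>f\<close>:
  ends are excluded because their images are jumps, and \<open>y \<noteq> x\<close> discards the
  fixed vertices off the paths. The lemma serves left and right paths alike.\<close>

lemma walk_family_closure:
  fixes tp e :: "'t \<Rightarrow> 'v" and p :: "'t \<Rightarrow> ('v \<times> 'v) awalk" and s a :: "'i \<Rightarrow> 'v"
  assumes fin: "finite TT" "finite I"
    and walk: "\<And>T. T \<in> TT \<Longrightarrow> pcas (tp T) (p T) (e T)"
    and dist: "\<And>T. T \<in> TT \<Longrightarrow> distinct (pawalk_verts (tp T) (p T))"
    and disj: "pairwise (\<lambda>T T'. disjnt (set (pawalk_verts (tp T) (p T)))
      (set (pawalk_verts (tp T') (p T')))) TT"
    and s: "bij_betw s I (tp ` TT)" and a: "inj_on a I" and \<alpha>: "\<alpha> permutes I"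
    and \<alpha>_eq: "\<And>T j. T \<in> TT \<Longrightarrow> j \<in> I \<Longrightarrow> tp T = s j \<Longrightarrow> e T = a (\<alpha> j)"
  shows "\<exists>f. permutation f \<and> sign f = sign \<alpha> * (-1) ^ (\<Sum>T\<in>TT. length (p T)) \<and>
    (\<forall>i\<in>I. f (a i) = s i) \<and>
    (\<forall>x y. (\<Sum>T\<in>TT. count_list (p T) (x, y)) = of_bool (x \<notin> a ` I \<and> f x = y \<and> y \<noteq> x))"
proof -
  define P where "P T = pawalk_verts (tp T) (p T)" for T
  have tp_in: "tp T \<in> set (P T)" and e_in: "e T \<in> set (P T)" if "T \<in> TT" for T
    using walk[OF that] pcas_last_in[OF walk[OF that]] by (simp_all add: P_def pawalk_verts_pcas)
  have uniq: "T = T'" if "T \<in> TT" "T' \<in> TT" "x \<in> set (P T)" "x \<in> set (P T')" for T T' x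
    using disj that unfolding pairwise_def disjnt_def P_def by blast
  obtain c where c: "c permutes (\<Union>T\<in>TT. set (P T))"
    "sign c = (-1) ^ (\<Sum>T\<in>TT. length (P T) - 1)"
    "\<And>T x. T \<in> TT \<Longrightarrow> x \<in> set (P T) \<Longrightarrow> c x = cycle_of_list (P T) x"
    using disjoint_cycles[of TT P] fin(1) dist uniq by (metis P_def disjoint_iff)
  have c_e: "c (e T) = tp T" if "T \<in> TT" for T
    using c(3)[OF that e_in[OF that]] cycle_of_walk(1)[OF walk dist] that by (simp add: P_def)
  have c_arc: "c x = y" if "T \<in> TT" "(x, y) \<in> set (p T)" for T x y
    using c(3)[of T x] cycle_of_walk(2)[OF walk dist] arc_in_pawalk_verts[OF walk] that
    by (simp add: P_def)
  \<comment> \<open>This is \<open>\<alpha>\<close> transported to the starts along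
    \<open>s\<close>. The path starting at \<open>s j\<close> ends at \<open>a (\<alpha> j)\<close>,
    so \<open>d\<close> moves the return point \<open>s j\<close> to the required
    \<open>s (\<alpha> j)\<close>.\<close>
  define d where "d = map_permutation I s \<alpha>"
  have s_inj: "inj_on s I" using s by (simp add: bij_betw_def)
  have d: "d permutes tp ` TT" "sign d = sign \<alpha>"
    unfolding d_def by (rule map_permutation_permutes[OF s \<alpha>])
      (rule sign_map_permutation[OF s_inj \<alpha> fin(2)])
  have d_s: "d (s j) = s (\<alpha> j)" if "j \<in> I" for j
    using map_permutation_apply[OF s_inj that] by (simp add: d_def)
  have index: "\<exists>j\<in>I. tp T = s j" if "T \<in> TT" for T
    using imageI[OF that, of tp] unfolding bij_betw_imp_surj_on[OF s, symmetric] by blast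
  have ends: "\<exists>T\<in>TT. e T = a i \<and> d (tp T) = s i" if i: "i \<in> I" for i
  proof -
    have "i \<in> \<alpha> ` I" using permutes_image[OF \<alpha>] i by simp
    then obtain j where j: "j \<in> I" "\<alpha> j = i" by auto
    have "s j \<in> tp ` TT" using bij_betw_apply[OF s j(1)] .
    then obtain T where T: "T \<in> TT" "tp T = s j" by auto
    show ?thesis using \<alpha>_eq[OF T(1) j(1) T(2)] d_s[OF j(1)] j T by auto
  qed
  have e_a: "e ` TT = a ` I"
  proof
    show "e ` TT \<subseteq> a ` I"
      using index \<alpha>_eq permutes_in_image[OF \<alpha>] by fastforce
    show "a ` I \<subseteq> e ` TT" using ends by force
  qed
  define f where "f = d \<circ> c"
  have perm: "permutation d" "permutation c"
    using permutes_imp_permutation[OF _ d(1)] permutes_imp_permutation[OF _ c(1)] fin by auto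
  have f_arc: "f x = y" if "T \<in> TT" "(x, y) \<in> set (p T)" for T x y
  proof -
    \<comment> \<open>The head of an arc is not the start of its own path by distinctness, nor of
      another one by disjointness, so \<open>d\<close> does not disturb it.\<close>
    have "y \<noteq> tp T'" if "T' \<in> TT" for T'
      using uniq[of T T' y] arc_ends_neq[OF walk dist] \<open>T \<in> TT\<close> \<open>(x, y) \<in> set (p T)\<close> tp_in that
      by (metis P_def)
    then have "d y = y" using permutes_not_in[OF d(1)] by blast
    then show ?thesis using c_arc[OF that] by (simp add: f_def)
  qed
  have f_fix: "f x = x" if "\<And>T. T \<in> TT \<Longrightarrow> x \<notin> set (P T)" for x
  proof -
    have "c x = x" using that by (intro permutes_not_in[OF c(1)]) auto
    moreover have "d x = x" using that tp_in by (intro permutes_not_in[OF d(1)]) auto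
    ultimately show ?thesis by (simp add: f_def)
  qed
  have arc_iff: "(\<exists>T\<in>TT. (x, y) \<in> set (p T)) \<longleftrightarrow> x \<notin> a ` I \<and> f x = y \<and> y \<noteq> x" for x y
  proof
    assume "\<exists>T\<in>TT. (x, y) \<in> set (p T)"
    then obtain T where T: "T \<in> TT" "(x, y) \<in> set (p T)" by blast
    note w = walk[OF T(1)] dist[OF T(1)] T(2)
    have "x \<in> set (P T)" using arc_in_pawalk_verts w by (simp add: P_def)
    then have "x \<notin> e ` TT"
      using uniq[OF T(1)] e_in arc_start_not_last[OF w] by blast
    then show "x \<notin> a ` I \<and> f x = y \<and> y \<noteq> x"
      using arc_ends_neq[OF w] f_arc[OF T] e_a by auto
  next
    \<comment> \<open>A moved vertex lies on some path. As it is not the end of that path, an arc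
      leaves it, and the head of this arc must be \<open>f x\<close>.\<close>
    assume r: "x \<notin> a ` I \<and> f x = y \<and> y \<noteq> x"
    then obtain T where T: "T \<in> TT" "x \<in> set (P T)" using f_fix by metis
    then obtain y' where "(x, y') \<in> set (p T)"
      using pawalk_verts_arc[OF walk[OF T(1)]] r e_a by (metis P_def imageI)
    with f_arc T r show "\<exists>T\<in>TT. (x, y) \<in> set (p T)" by metis
  qed
  have count: "count_list (p T) z = of_bool (z \<in> set (p T))" if "T \<in> TT" for T z
  proof -
    have "distinct (p T)"
      using dist[OF that] by (simp add: pawalk_verts_pcas[OF walk[OF that]] distinct_map)
    then show ?thesis by (rule distinct_count_list)
  qed
  have "(\<Sum>T\<in>TT. count_list (p T) (x, y)) = of_bool (\<exists>T\<in>TT. (x, y) \<in> set (p T))" for x y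
  proof (cases "\<exists>T\<in>TT. (x, y) \<in> set (p T)")
    case True
    then obtain T where T: "T \<in> TT" "(x, y) \<in> set (p T)" by blast
    have "(x, y) \<notin> set (p T')" if "T' \<in> TT" "T' \<noteq> T" for T'
      using uniq[of T T' x] arc_in_pawalk_verts[OF walk] T that by (metis P_def)
    \<comment> \<open>By disjointness only one path can pass through \<open>x\<close>, so the sum
      reduces to a single term.\<close>
    then have "(\<Sum>T'\<in>TT. count_list (p T') (x, y)) = (\<Sum>T'\<in>{T}. count_list (p T') (x, y))"
      using T fin by (intro sum.mono_neutral_right) (auto simp: count)
    then show ?thesis using T by (auto simp: count)
  qed (simp add: count)
  moreover have "sign f = sign \<alpha> * (-1) ^ (\<Sum>T\<in>TT. length (p T))"
  proof -
    have "length (P T) - 1 = length (p T)" if "T \<in> TT" for T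
      by (simp add: P_def pawalk_verts_pcas[OF walk[OF that]])
    then show ?thesis using perm c(2) d(2) by (simp add: f_def sign_compose del: o_apply)
  qed
  moreover have "permutation f" using perm by (simp add: f_def permutation_compose)
  moreover have "f (a i) = s i" if "i \<in> I" for i
  proof -
    obtain T where T: "T \<in> TT" "e T = a i" "d (tp T) = s i" using ends[OF \<open>i \<in> I\<close>] by blast
    show ?thesis using c_e[OF T(1)] T by (simp add: f_def)
  qed
  ultimately show ?thesis using arc_iff by (intro exI[of _ f]) simp
qed

text \<open>Each element of \<open>X\<close> gets one index from \<open>f\<close> and
  \<open>s\<close> and another from \<open>g\<close> and \<open>a\<close>; passing from the first to
  the second permutes \<open>I\<close>. With \<open>X\<close> a trek system and \<open>f\<close> the
  top, this supplies the \<open>\<alpha>\<close> of \<open>walk_family_closure\<close>.\<close>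

lemma ex_index_permutation:
  assumes s: "bij_betw s I (f ` X)" and f: "inj_on f X"
    and a: "bij_betw a I A" and g: "bij_betw g X A"
  shows "\<exists>\<alpha>. \<alpha> permutes I \<and> (\<forall>x\<in>X. \<forall>j\<in>I. f x = s j \<longrightarrow> g x = a (\<alpha> j))"
proof -
  define t where "t = inv_into X f \<circ> s"
  have t: "bij_betw t I X"
    unfolding t_def by (rule bij_betw_trans[OF s bij_betw_inv_into[OF inj_on_imp_bij_betw[OF f]]])
  define q where "q = inv_into I a \<circ> (g \<circ> t)"
  have q: "bij_betw q I I"
    unfolding q_def using t g bij_betw_inv_into[OF a] by (meson bij_betw_trans)
  have "restrict_id q I permutes I"
    using q by (intro bij_imp_permutes bij_betw_restrict_id) auto
  moreover have "g x = a (restrict_id q I j)" if "x \<in> X" "j \<in> I" "f x = s j" for x j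
  proof -
    have "t j = x" using that f by (simp add: t_def flip: that(3))
    moreover have "g x \<in> a ` I" using that a g by (metis bij_betw_apply bij_betw_imp_surj_on)
    ultimately show ?thesis using that by (simp add: q_def f_inv_into_f)
  qed
  ultimately show ?thesis by blast
qed

section \<open>Exponent vectors of trek monomials\<close>

definition path_exponent :: "('v \<times> 'v) awalk \<Rightarrow> 'v indet \<Rightarrow>\<^sub>0 nat" where
  "path_exponent p = (\<Sum>(k, l)\<leftarrow>p. Poly_Mapping.single (Lambda k l) 1)"

definition trek_exponent :: "'v trek \<Rightarrow> 'v indet \<Rightarrow>\<^sub>0 nat" where
  "trek_exponent T = Poly_Mapping.single (Omega (trek_top T)) 1 +
     path_exponent (trek_left T) + path_exponent (trek_right T)"

lemma path_monomial_eq: "path_monomial p = Poly_Mapping.single (path_exponent p) 1"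
  by (induction p) (auto simp: path_monomial_def path_exponent_def indet_poly_def mult_single)

text \<open>As the polynomial is a single term with coefficient 1, equality of system monomials
  amounts to equality of exponent vectors.\<close>

lemma system_monomial_eq:
  "system_monomial TT = Poly_Mapping.single (\<Sum>T\<in>TT. trek_exponent T) 1"
  unfolding system_monomial_def
  by (induction TT rule: infinite_finite_induct)
    (simp_all add: trek_monomial_def trek_exponent_def path_monomial_eq indet_poly_def mult_single)

lemma lookup_path_exponent:
  "Poly_Mapping.lookup (path_exponent p) (Lambda x y) = count_list p (x, y)"
  "Poly_Mapping.lookup (path_exponent p) (Omega v) = 0"
  by (induction p) (auto simp: path_exponent_def lookup_add lookup_single when_def split: if_splits)

lemma lookup_system_exponent:
  "Poly_Mapping.lookup (\<Sum>T\<in>TT. trek_exponent T) (Lambda x y) =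
     (\<Sum>T\<in>TT. count_list (trek_left T) (x, y)) + (\<Sum>T\<in>TT. count_list (trek_right T) (x, y))"
  "Poly_Mapping.lookup (\<Sum>T\<in>TT. trek_exponent T) (Omega v) = (\<Sum>T\<in>TT. of_bool (trek_top T = v))"
  by (auto simp: lookup_sum trek_exponent_def lookup_add lookup_single lookup_path_exponent
    sum.distrib when_def intro!: sum.cong)

text \<open>The exponent of \<open>Omega v\<close> counts the treks with top \<open>v\<close>. Hence
  systems with equal monomials have the same tops and can share one enumeration of them.\<close>

lemma tops_eq:
  assumes "finite TT"
  shows "trek_top ` TT = {v. Poly_Mapping.lookup (\<Sum>T\<in>TT. trek_exponent T) (Omega v) \<noteq> 0}"
  using assms by (auto simp: lookup_system_exponent)


section \<open>The sign of a trek system\<close>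

text \<open>Applies \<open>walk_family_closure\<close> to the left and to the right paths. The
  enumeration \<open>s\<close> is a parameter so that two systems can be treated with the same one;
  the power of -1 depends only on the exponents.\<close>

lemma trek_system_closures:
  assumes G: "pair_digraph G" "acyclic (parcs G)"
    and a: "bij_betw a {1..k} A" and b: "bij_betw b {1..k} B"
    and TT: "is_trek_system G k A B TT" "no_sided_intersection TT"
    and s: "bij_betw s {1..k} (trek_top ` TT)"
  defines "E \<equiv> Poly_Mapping.lookup (\<Sum>T\<in>TT. trek_exponent T)"
  shows "\<exists>f g. permutation f \<and> permutation g \<and>
    system_sign k a b TT = sign f * sign g * (-1) ^ (\<Sum>(x, y)\<in>parcs G. E (Lambda x y)) \<and>
    (\<forall>i\<in>{1..k}. f (a i) = s i \<and> g (b i) = s i) \<and>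
    (\<forall>x y. E (Lambda x y) = of_bool (x \<notin> A \<and> f x = y \<and> y \<noteq> x) + of_bool (x \<notin> B \<and> g x = y \<and> y \<noteq> x))"
proof -
  let ?I = "{1..k}"
  interpret pair_digraph G by (rule G(1))
  have fin: "finite TT" "card TT = k" "trek_initial ` TT = A" "trek_final ` TT = B"
    using TT by (auto simp: is_trek_system_def)
  have imgs: "a ` ?I = A" "b ` ?I = B" "inj_on a ?I" "inj_on b ?I"
    using a b by (auto simp: bij_betw_def)
  have wl: "pcas (trek_top T) (trek_left T) (trek_initial T)" "set (trek_left T) \<subseteq> parcs G"
    and wr: "pcas (trek_top T) (trek_right T) (trek_final T)" "set (trek_right T) \<subseteq> parcs G"
    if "T \<in> TT" for T
    using TT(1) that by (auto simp: is_trek_system_def is_trek_def pre_digraph.awalk_def)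
  have dl: "distinct (pawalk_verts (trek_top T) (trek_left T))"
    and dr: "distinct (pawalk_verts (trek_top T) (trek_right T))" if "T \<in> TT" for T
    using acyclic_distinct_pawalk_verts[OF G(2)] wl wr that by blast+
  have disj:
    "pairwise (\<lambda>T T'. disjnt (set (pawalk_verts (trek_top T) (trek_left T)))
      (set (pawalk_verts (trek_top T') (trek_left T')))) TT"
    "pairwise (\<lambda>T T'. disjnt (set (pawalk_verts (trek_top T) (trek_right T)))
      (set (pawalk_verts (trek_top T') (trek_right T')))) TT"
    using TT(2) by (auto simp: no_sided_intersection_def left_verts_def right_verts_def)
  have top_inj: "inj_on trek_top TT"
    by (rule eq_card_imp_inj_on) (use fin bij_betw_same_card[OF s] in auto)
  have bij: "bij_betw trek_initial TT A" "bij_betw trek_final TT B"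
    using fin bij_betw_same_card[OF a] bij_betw_same_card[OF b]
    by (auto simp: bij_betw_def intro!: eq_card_imp_inj_on)
  obtain \<alpha> where \<alpha>: "\<alpha> permutes ?I"
    "\<And>T j. T \<in> TT \<Longrightarrow> j \<in> ?I \<Longrightarrow> trek_top T = s j \<Longrightarrow> trek_initial T = a (\<alpha> j)"
    using ex_index_permutation[OF s top_inj a bij(1)] by metis
  obtain \<beta> where \<beta>: "\<beta> permutes ?I"
    "\<And>T j. T \<in> TT \<Longrightarrow> j \<in> ?I \<Longrightarrow> trek_top T = s j \<Longrightarrow> trek_final T = b (\<beta> j)"
    using ex_index_permutation[OF s top_inj b bij(2)] by metis
  obtain f where f: "permutation f"
    "sign f = sign \<alpha> * (-1) ^ (\<Sum>T\<in>TT. length (trek_left T))" "\<And>i. i \<in> ?I \<Longrightarrow> f (a i) = s i"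
    "\<And>x y. (\<Sum>T\<in>TT. count_list (trek_left T) (x, y)) = of_bool (x \<notin> A \<and> f x = y \<and> y \<noteq> x)"
    using walk_family_closure[OF fin(1) finite_atLeastAtMost wl(1) dl disj(1) s imgs(3) \<alpha>]
    unfolding imgs by blast
  obtain g where g: "permutation g"
    "sign g = sign \<beta> * (-1) ^ (\<Sum>T\<in>TT. length (trek_right T))" "\<And>i. i \<in> ?I \<Longrightarrow> g (b i) = s i"
    "\<And>x y. (\<Sum>T\<in>TT. count_list (trek_right T) (x, y)) = of_bool (x \<notin> B \<and> g x = y \<and> y \<noteq> x)"
    using walk_family_closure[OF fin(1) finite_atLeastAtMost wr(1) dr disj(2) s imgs(4) \<beta>]
    unfolding imgs by blast
  have E: "E (Lambda x y) = (\<Sum>T\<in>TT. count_list (trek_left T) (x, y)) +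
    (\<Sum>T\<in>TT. count_list (trek_right T) (x, y))" for x y
    by (simp add: E_def lookup_system_exponent)
  \<comment> \<open>All arcs of the paths lie in the finite set \<open>parcs G\<close>, so counting
    arc by arc gives the lengths. The total is the degree in the \<open>Lambda\<close>
    indeterminates.\<close>
  have lengths: "(\<Sum>z\<in>parcs G. \<Sum>T\<in>TT. count_list (p T) z) = (\<Sum>T\<in>TT. length (p T))"
    if "\<And>T. T \<in> TT \<Longrightarrow> set (p T) \<subseteq> parcs G" for p :: "'a trek \<Rightarrow> ('a \<times> 'a) list"
    using that by (subst sum.swap) (simp add: sum_count_set)
  have degree: "(\<Sum>(x, y)\<in>parcs G. E (Lambda x y)) =
    (\<Sum>T\<in>TT. length (trek_left T)) + (\<Sum>T\<in>TT. length (trek_right T))"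
    by (simp add: E sum.distrib lengths wl wr split_def)
  have perm: "permutation \<alpha>" "permutation \<beta>"
    using \<alpha>(1) \<beta>(1) by (auto intro: permutes_imp_permutation)
  \<comment> \<open>From the index of the initial vertex back to that of the top, then on to that of
    the final vertex.\<close>
  define \<pi> where "\<pi> = \<beta> \<circ> inv \<alpha>"
  have "is_system_perm k a b TT \<pi>"
    unfolding is_system_perm_def
  proof (intro conjI ballI impI)
    show "\<pi> permutes ?I"
      unfolding \<pi>_def using \<alpha>(1) \<beta>(1) by (intro permutes_compose permutes_inv)
    fix T i assume T: "T \<in> TT" "i \<in> ?I" "trek_initial T = a i"
    obtain j where j: "j \<in> ?I" "trek_top T = s j"
      using s T(1) by (metis bij_betw_def imageE imageI)
    then have "\<alpha> j = i"
      using \<alpha>(2)[OF T(1) j] T imgs(3) permutes_in_image[OF \<alpha>(1)] by (metis inj_onD)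
    then have "\<pi> i = \<beta> j" using permutes_inverses(2)[OF \<alpha>(1)] by (auto simp: \<pi>_def)
    then show "trek_final T = b (\<pi> i)" using \<beta>(2)[OF T(1) j] by simp
  qed
  then have "system_perm k a b TT = \<pi>"
    unfolding system_perm_def using ex1_system_perm[OF a b TT(1)] by (metis the1_equality)
  then have "system_sign k a b TT = sign \<alpha> * sign \<beta>"
    using perm by (simp add: system_sign_def \<pi>_def sign_compose permutation_inverse sign_inverse
      del: o_apply)
  also have "\<dots> = sign f * sign g * (-1) ^ (\<Sum>(x, y)\<in>parcs G. E (Lambda x y))"
    by (cases "even (\<Sum>T\<in>TT. length (trek_left T))"; cases "even (\<Sum>T\<in>TT. length (trek_right T))")
      (simp_all add: f(2) g(2) degree power_add)
  finally show ?thesis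
    using f g E by (intro exI[of _ f] exI[of _ g]) simp
qed

section \<open>Comparing two systems with the same monomial\<close>

text \<open>A multiset of two elements is determined by its multiplicities away from
  \<open>x\<close>, because \<open>x\<close> fills up the remaining places.\<close>

lemma pair_eq_of_counts:
  fixes p q p' q' x :: 'a
  assumes "\<And>y. y \<noteq> x \<Longrightarrow> of_bool (p = y) + of_bool (q = y) = (of_bool (p' = y) + of_bool (q' = y) :: nat)"
  shows "p' = p \<and> q' = q \<or> p' = q \<and> q' = p"
  using assms[of p] assms[of q] assms[of p'] assms[of q']
  by (cases "p = x"; cases "q = x"; cases "p' = x"; cases "q' = x";
      cases "p = q"; cases "p' = p"; cases "q' = p"; cases "p' = q"; cases "q' = q") simp_all

text \<open>A value at a vertex of \<open>A\<close> or \<open>B\<close> is prescribed and leaves no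
  trace in the counts. If one value is prescribed, the counts determine the other; if none is, they
  determine the two values up to order.\<close>

lemma exchange_of_counts:
  fixes f g f' g' :: "'a \<Rightarrow> 'a"
  assumes eq: "\<And>y. of_bool (x \<notin> A \<and> f x = y \<and> y \<noteq> x) + of_bool (x \<notin> B \<and> g x = y \<and> y \<noteq> x) =
      (of_bool (x \<notin> A \<and> f' x = y \<and> y \<noteq> x) + of_bool (x \<notin> B \<and> g' x = y \<and> y \<noteq> x) :: nat)"
    and "x \<in> A \<Longrightarrow> f' x = f x" and "x \<in> B \<Longrightarrow> g' x = g x"
  shows "f' x = f x \<and> g' x = g x \<or> f' x = g x \<and> g' x = f x"
proof (cases "x \<in> A \<or> x \<in> B")
  case True
  have "f' x = f x" if "x \<notin> A"
  proof -
    \<comment> \<open>Here \<open>x\<close> lies in \<open>B\<close>, so the terms of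
      \<open>g\<close> and \<open>g'\<close> vanish. If no \<open>y\<close> other than
      \<open>x\<close> is attained, both values are \<open>x\<close>.\<close>
    have "f x = y \<longleftrightarrow> f' x = y" if "y \<noteq> x" for y
      using eq[of y] that True \<open>x \<notin> A\<close> assms(3) by (auto simp: of_bool_eq_iff)
    then show ?thesis by metis
  qed
  moreover have "g' x = g x" if "x \<notin> B"
  proof -
    have "g x = y \<longleftrightarrow> g' x = y" if "y \<noteq> x" for y
      using eq[of y] that True \<open>x \<notin> B\<close> assms(2) by (auto simp: of_bool_eq_iff)
    then show ?thesis by metis
  qed
  ultimately show ?thesis using assms(2,3) by auto
next
  case False
  then have "of_bool (f x = y) + of_bool (g x = y) =
      (of_bool (f' x = y) + of_bool (g' x = y) :: nat)" if "y \<noteq> x" for y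
    using eq[of y] that by simp
  then show ?thesis by (rule pair_eq_of_counts)
qed

theorem theorem3p3:
  fixes G :: "'v pair_pre_digraph" and A B :: "'v set" and k :: nat
    and a b :: "nat \<Rightarrow> 'v" and TT TT' :: "'v trek set"
  assumes "pair_digraph G" and "acyclic (parcs G)"
    and "A \<subseteq> pverts G" and "B \<subseteq> pverts G"
    and "card A = k" and "card B = k"
    and "bij_betw a {1..k} A" and "bij_betw b {1..k} B"
    and "is_trek_system G k A B TT" and "is_trek_system G k A B TT'"
    and "no_sided_intersection TT" and "no_sided_intersection TT'"
    and "system_monomial TT = system_monomial TT'"
  shows "system_sign k a b TT = system_sign k a b TT'"
proof -
  let ?E = "\<lambda>TT. Poly_Mapping.lookup (\<Sum>T\<in>TT. trek_exponent T) :: 'v indet \<Rightarrow> nat"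
  \<comment> \<open>Each polynomial has its exponent vector as the only key.\<close>
  have E: "?E TT = ?E TT'"
    using arg_cong[OF assms(13), where f = Poly_Mapping.keys] by (simp add: system_monomial_eq)
  have fin: "finite TT" "finite TT'" "card TT = k"
    using assms(9,10) by (auto simp: is_trek_system_def)
  have tops: "trek_top ` TT = trek_top ` TT'"
    using fin E by (simp add: tops_eq)
  have "inj_on trek_top TT"
  proof (rule inj_onI, rule ccontr)
    fix T T' assume T: "T \<in> TT" "T' \<in> TT" "trek_top T = trek_top T'" "T \<noteq> T'"
    \<comment> \<open>Two treks with a common top would have left paths meeting in it, so the tops
      are distinct and there are \<open>k\<close> of them.\<close>
    have "trek_top S \<in> set (left_verts S)" if "S \<in> TT" for S
      using assms(9) that
      by (auto simp: left_verts_def is_trek_system_def is_trek_def pre_digraph.awalk_def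
          cas_with_proj_eq pawalk_verts_pcas)
    with T assms(11) show False
      unfolding no_sided_intersection_def pairwise_def disjnt_def by (metis disjoint_iff)
  qed
  then have "card (trek_top ` TT) = k" using fin by (simp add: card_image)
  then obtain s where s: "bij_betw s {1..k} (trek_top ` TT)"
    using fin by (metis ex_bij_betw_nat_finite_1 finite_imageI)
  obtain f g where fg: "permutation f" "permutation g"
    "system_sign k a b TT = sign f * sign g * (-1) ^ (\<Sum>(x, y)\<in>parcs G. ?E TT (Lambda x y))"
    "\<forall>i\<in>{1..k}. f (a i) = s i \<and> g (b i) = s i"
    "\<forall>x y. ?E TT (Lambda x y) =
      of_bool (x \<notin> A \<and> f x = y \<and> y \<noteq> x) + of_bool (x \<notin> B \<and> g x = y \<and> y \<noteq> x)"
    using trek_system_closures[OF assms(1,2,7,8,9,11) s] by blast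
  obtain f' g' where fg': "permutation f'" "permutation g'"
    "system_sign k a b TT' = sign f' * sign g' * (-1) ^ (\<Sum>(x, y)\<in>parcs G. ?E TT' (Lambda x y))"
    "\<forall>i\<in>{1..k}. f' (a i) = s i \<and> g' (b i) = s i"
    "\<forall>x y. ?E TT' (Lambda x y) =
      of_bool (x \<notin> A \<and> f' x = y \<and> y \<noteq> x) + of_bool (x \<notin> B \<and> g' x = y \<and> y \<noteq> x)"
    using trek_system_closures[OF assms(1,2,7,8,10,12) s[unfolded tops]] by blast
  have "f' x = f x \<and> g' x = g x \<or> f' x = g x \<and> g' x = f x" for x
  proof (rule exchange_of_counts[where f = f and g = g and f' = f' and g' = g' and A = A and B = B])
    show "of_bool (x \<notin> A \<and> f x = y \<and> y \<noteq> x) + of_bool (x \<notin> B \<and> g x = y \<and> y \<noteq> x) =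
      (of_bool (x \<notin> A \<and> f' x = y \<and> y \<noteq> x) + of_bool (x \<notin> B \<and> g' x = y \<and> y \<noteq> x) :: nat)" for y
      using fg(5) fg'(5) E by metis
    \<comment> \<open>Both closures send \<open>a i\<close> to \<open>s i\<close> with the same
      \<open>s\<close>.\<close>
    show "f' x = f x" if "x \<in> A"
      using that assms(7) fg(4) fg'(4) by (metis bij_betw_def imageE)
    show "g' x = g x" if "x \<in> B"
      using that assms(8) fg(4) fg'(4) by (metis bij_betw_def imageE)
  qed
  then have "sign f' * sign g' = sign f * sign g"
    using fg fg' by (intro sign_exchange)
  \<comment> \<open>The remaining power of -1 is the same for both systems, since the exponent
    vectors agree.\<close>
  then show ?thesis using fg(3) fg'(3) E by simp
qed

end
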